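(* Let $\xi$ be an ordinal, let $S$ be a set and let $T$ be a $B$-tree on $S$. Then: (i) $\mathcal{T}_\xi$ is a $B$-tree on $[1,\xi]$ with $o(\mathcal{T}_\xi)=\xi$. (ii) If $\mathcal{T}$ is a $B$-tree (on any set) and there exists an order preserving map $f:\mathcal{T}\to T$, then $o(T)\geqslant o(\mathcal{T})$. (iii) $o(T)\geqslant \xi$ if and only if there exists an order preserving map $f:\mathcal{T}_\xi\to T$. (iv) $o(T)\geqslant \xi$ if and only if there exists a function $f:\mathcal{T}_\xi\to S$ so that for each $t\in\mathcal{T}_\xi$, $(f(t|_i))_{i=1}^{|t|}\in T$.
   Context: For a set $S$, $S^{<\omega}$ denotes the finite sequences in $S$, including the empty sequence $\varnothing$; $|s|$ is the length of $s$, $s|_n$ is the initial segment of $s$ of length $n$, and $s^\frown t$ is concatenation. Write $s\prec t$ if $s$ is a proper initial segment of $t$. A subset $T\subset S^{<\omega}$ is a tree if it is closed under initial segments; $T\subset S^{<\omega}\setminus\{\varnothing\}$ is a $B$-tree on $S$ if $T\cup\{\varnothing\}$ is a tree. $MAX(T)$ is the set of $\prec$-maximal members of $T$, $T'=T\setminus MAX(T)$, and $d^0(T)=T$, $d^{\xi+1}(T)=(d^\xi(T))'$, $d^\xi(T)=\bigcap_{\zeta<\xi}d^\zeta(T)$ for $\xi$ a limit ordinal. $o(T)=\min\{\xi: d^\xi(T)=\varnothing\}$ if such an ordinal exists and $o(T)=\infty$ otherwise, where $\xi<\infty$ for every ordinal $\xi$. A map $f:P\to Q$ between partially ordered sets is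 order preserving if $x<_P y$ implies $f(x)<_Q f(y)$ (only this implication); (B-)trees are ordered by $\prec$. Minimal trees: $\mathcal{MT}_0=\{\varnothing\}$, $\mathcal{MT}_{\xi+1}=\{\varnothing\}\cup\{(\xi+1)^\frown t: t\in\mathcal{MT}_\xi\}$, $\mathcal{MT}_\xi=\bigcup_{\zeta<\xi}\mathcal{MT}_{\zeta+1}$ for $\xi$ a limit ordinal, and $\mathcal{T}_\xi=\mathcal{MT}_\xi\setminus\{\varnothing\}$. *)

theory Defs
  imports "HOL-Library.FuncSet" "HOL-Library.Sublist" "HOL-Library.Extended"
begin

text \<open>
  HOL has no type of all ordinals. Ordinals are the elements of an arbitrary well-ordered type
  \<open>'o\<close> without greatest element, an element standing for the order type of the set of its
  predecessors; every ordinal occurs in some such \<open>'o\<close>. The absence of a greatest element makes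
  the type closed under successor.
\<close>

definition ord_zero :: "'o::wellorder" where
  "ord_zero = (LEAST x. True)"

definition ord_succ :: "'o::{wellorder,no_top} \<Rightarrow> 'o" where
  "ord_succ x = (LEAST y. x < y)"

definition is_limit :: "'o::{wellorder,no_top} \<Rightarrow> bool" where
  "is_limit x \<longleftrightarrow> x \<noteq> ord_zero \<and> (\<forall>y. x \<noteq> ord_succ y)"

lemma ord_zero_le: "ord_zero \<le> (x::'o::wellorder)"
  unfolding ord_zero_def by (simp add: Least_le)

lemma less_ord_succ: "x < ord_succ (x::'o::{wellorder,no_top})"
  unfolding ord_succ_def using gt_ex[of x] by (metis LeastI)

lemma ord_succ_le: "x < y \<Longrightarrow> ord_succ x \<le> (y::'o::{wellorder,no_top})"
  unfolding ord_succ_def by (rule Least_le)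

lemma less_ord_succ_iff: "x < ord_succ y \<longleftrightarrow> x \<le> (y::'o::{wellorder,no_top})"
  by (meson leD leI less_ord_succ le_less_trans ord_succ_le)

lemma ord_succ_inject: "ord_succ x = ord_succ y \<longleftrightarrow> x = (y::'o::{wellorder,no_top})"
  by (metis antisym less_ord_succ less_ord_succ_iff)

lemma ord_succ_neq_zero: "ord_succ x \<noteq> (ord_zero::'o::{wellorder,no_top})"
  by (metis leD less_ord_succ ord_zero_le)

lemma ord_cases:
  fixes x :: "'o::{wellorder,no_top}"
  obtains "x = ord_zero" | y where "x = ord_succ y" | "is_limit x"
  unfolding is_limit_def by blast

lemma is_limit_succ_less:
  fixes x :: "'o::{wellorder,no_top}"
  assumes "is_limit x" "y < x"
  shows "ord_succ y < x"
  using assms by (metis is_limit_def le_less ord_succ_le)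

lemma not_is_limit [simp]:
  "\<not> is_limit (ord_zero::'o::{wellorder,no_top})"
  "\<not> is_limit (ord_succ (y::'o::{wellorder,no_top}))"
  by (auto simp: is_limit_def)

lemma wf_less_wellorder: "wf {(x, y). x < (y::'o::wellorder)}"
  by (rule wf)

definition is_tree :: "'a set \<Rightarrow> 'a list set \<Rightarrow> bool" where
  "is_tree S T \<longleftrightarrow> T \<subseteq> lists S \<and> (\<forall>t\<in>T. \<forall>s. prefix s t \<longrightarrow> s \<in> T)"

definition is_B_tree :: "'a set \<Rightarrow> 'a list set \<Rightarrow> bool" where
  "is_B_tree S T \<longleftrightarrow> T \<subseteq> lists S - {[]} \<and> is_tree S (T \<union> {[]})"

definition max_nodes :: "'a list set \<Rightarrow> 'a list set" where
  "max_nodes T = {t \<in> T. \<not> (\<exists>s\<in>T. strict_prefix t s)}"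

function tree_deriv :: "'o::{wellorder,no_top} \<Rightarrow> 'a list set \<Rightarrow> 'a list set" where
  "tree_deriv ord_zero T = T"
| "tree_deriv (ord_succ \<xi>) T = tree_deriv \<xi> T - max_nodes (tree_deriv \<xi> T)"
| "is_limit \<xi> \<Longrightarrow> tree_deriv \<xi> T = (\<Inter>\<zeta>\<in>{..<\<xi>}. tree_deriv \<zeta> T)"
  by (metis ord_cases surj_pair)
     (auto simp: ord_succ_inject ord_succ_neq_zero ord_succ_neq_zero[symmetric])
termination
  by (relation "inv_image {(x, y). x < y} fst") (auto simp: wf_less_wellorder less_ord_succ)

text \<open>
  The value \<open>Pinf\<close> plays the role of \<open>\<infinity>\<close>; the value \<open>Minf\<close> of the library type never occurs.
  The minimum is taken over the ordinals in \<open>'o\<close>. For \<open>\<xi>\<close> in \<open>'o\<close> the relation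
  \<open>Fin \<xi> \<le> tree_order T\<close> thus has its true meaning whatever \<open>'o\<close> is, and once \<open>'o\<close> does not
  inject into \<open>'a list\<close>, the value \<open>Pinf\<close> means that no ordinal whatsoever makes the
  derivative empty (lemma \<open>tree_order_Pinf_absolute\<close> below).
\<close>

definition tree_order :: "'a list set \<Rightarrow> 'o::{wellorder,no_top} extended" where
  "tree_order T = (if \<exists>\<xi>::'o. tree_deriv \<xi> T = {}
                   then Fin (LEAST \<xi>. tree_deriv \<xi> T = {}) else Pinf)"

definition tree_order_preserving ::
    "'a list set \<Rightarrow> 'b list set \<Rightarrow> ('a list \<Rightarrow> 'b list) \<Rightarrow> bool" where
  "tree_order_preserving P Q f \<longleftrightarrow> f \<in> P \<rightarrow> Q \<and> monotone_on P strict_prefix strict_prefix f"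

function MT :: "'o::{wellorder,no_top} \<Rightarrow> 'o list set" where
  "MT ord_zero = {[]}"
| "MT (ord_succ \<xi>) = {[]} \<union> {ord_succ \<xi> # t | t. t \<in> MT \<xi>}"
| "is_limit \<xi> \<Longrightarrow> MT \<xi> = (\<Union>\<zeta>\<in>{..<\<xi>}. MT (ord_succ \<zeta>))"
  by (metis ord_cases)
     (auto simp: ord_succ_inject ord_succ_neq_zero ord_succ_neq_zero[symmetric])
termination
  by (relation "{(x, y). x < y}") (auto simp: wf_less_wellorder less_ord_succ is_limit_succ_less)

definition min_tree :: "'o::{wellorder,no_top} \<Rightarrow> 'o list set" where
  "min_tree \<xi> = MT \<xi> - {[]}"

lemma tree_deriv_antimono:
  fixes \<xi> \<eta> :: "'o::{wellorder,no_top}"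
  assumes "\<xi> \<le> \<eta>"
  shows "tree_deriv \<eta> T \<subseteq> tree_deriv \<xi> T"
  using assms
proof (induction \<eta> rule: less_induct)
  case (less \<eta>)
  show ?case
  proof (cases "\<xi> = \<eta>")
    case False
    then have lt: "\<xi> < \<eta>" using less.prems by simp
    show ?thesis
    proof (cases \<eta> rule: ord_cases)
      case 1
      then show ?thesis using lt ord_zero_le leD by blast
    next
      case (2 y)
      then show ?thesis using less.IH[of y] lt less_ord_succ less_ord_succ_iff by auto
    next
      case 3
      then show ?thesis using lt by auto
    qed
  qed simp
qed

theorem tree_order_Pinf_absolute:
  fixes T :: "'a list set" and \<eta> :: "'p::{wellorder,no_top}"
  assumes large: "\<not> (\<exists>g :: 'o::{wellorder,no_top} \<Rightarrow> 'a list. inj g)"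
    and inf: "(tree_order T :: 'o extended) = Pinf"
  shows "tree_deriv \<eta> T \<noteq> {}"
proof -
  have ne: "tree_deriv \<xi> T \<noteq> {}" for \<xi> :: 'o
    using inf unfolding tree_order_def by (auto split: if_splits)
  have "\<exists>\<xi>::'o. tree_deriv (ord_succ \<xi>) T = tree_deriv \<xi> T"
  proof (rule ccontr)
    assume "\<not> ?thesis"
    then have "\<forall>\<xi>::'o. \<exists>t. t \<in> tree_deriv \<xi> T \<and> t \<notin> tree_deriv (ord_succ \<xi>) T"
      by fastforce
    then obtain g where
      g: "g \<xi> \<in> tree_deriv \<xi> T" "g \<xi> \<notin> tree_deriv (ord_succ \<xi>) T" for \<xi> :: 'o
      by metis
    have "g x \<noteq> g y" if "x < y" for x y
      using g[of x] g[of y] tree_deriv_antimono[OF ord_succ_le[OF that], of T] by auto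
    then have "inj g" by (metis injI linorder_neqE)
    then show False using large by blast
  qed
  then obtain \<xi> :: 'o where stable: "tree_deriv (ord_succ \<xi>) T = tree_deriv \<xi> T" ..
  define K where "K = tree_deriv \<xi> T"
  have K: "max_nodes K = {}" using stable by (auto simp: K_def max_nodes_def)
  have "K \<subseteq> tree_deriv \<eta> T"
  proof (induction \<eta> rule: less_induct)
    case (less \<eta>)
    show ?case
    proof (cases \<eta> rule: ord_cases)
      case 1
      then show ?thesis
        using tree_deriv_antimono[OF ord_zero_le[of \<xi>], of T] by (simp add: K_def)
    next
      case (2 y)
      then have "K \<subseteq> tree_deriv y T" using less less_ord_succ by blast
      moreover have "\<exists>s\<in>K. strict_prefix t s" if "t \<in> K" for t
        using K that by (auto simp: max_nodes_def)
      ultimately have "K \<inter> max_nodes (tree_deriv y T) = {}"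
        unfolding max_nodes_def by blast
      then show ?thesis using \<open>K \<subseteq> tree_deriv y T\<close> 2 by auto
    next
      case 3
      then show ?thesis using less by auto
    qed
  qed
  then show ?thesis using ne[of \<xi>] by (auto simp: K_def)
qed

end

theory Submission
  imports Defs
begin

text \<open>
  Everything rests on one reading of the minimal trees: their members are strictly decreasing
  sequences of successor ordinals, and the last entry of a node records how long the node survives
  derivation. A node ending in \<open>\<eta> + 1\<close> carries a copy of \<open>MT \<eta>\<close> above it, so it belongs to the
  \<open>\<zeta>\<close>-th derivative exactly when \<open>\<zeta> \<le> \<eta>\<close> (\<open>tree_deriv_min_tree\<close>). Since the first entries are
  cofinal among the successors up to \<open>\<xi>\<close>, the order of \<open>min_tree \<xi>\<close> is \<open>\<xi>\<close>.

  An order preserving map sends a node with a proper extension to a node with a proper extension,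
  hence maps derivatives into derivatives (\<open>tree_order_preserving_deriv\<close>), and the order cannot
  drop. Together with the order of \<open>min_tree \<xi>\<close> this shows that a map from \<open>min_tree \<xi>\<close> forces
  the order of the target to be at least \<open>\<xi>\<close>.

  For the converse one copies a node of \<open>min_tree \<xi>\<close> into \<open>T\<close> letter by letter (\<open>branch\<close>), keeping
  the image of a node that ends in \<open>\<eta> + 1\<close> inside the \<open>\<eta>\<close>-th derivative of \<open>T\<close>. The entries
  decrease, so the next one is \<open>\<eta>' + 1\<close> with \<open>\<eta>' < \<eta>\<close>; membership in the \<open>\<eta>\<close>-th derivative, which
  is contained in the derivative of index \<open>\<eta>' + 1\<close>, says that the image has a proper extension in
  the \<open>\<eta>'\<close>-th derivative, and by closure under initial segments one may extend by a single letter.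
  The image has the same length as the node and depends only on its entries so far, which gives the
  labelling of nodes by elements of \<open>S\<close>; a labelling in turn yields an order preserving map.
\<close>

section \<open>Minimal trees\<close>

lemma Nil_in_MT: "[] \<in> MT \<xi>"
proof (cases \<xi> rule: ord_cases)
  case 3
  then have "ord_zero < \<xi>" using ord_zero_le[of \<xi>] by (auto simp: is_limit_def order_le_less)
  then show ?thesis using 3 by auto
qed auto

text \<open>
  The set of possible continuations of a node depends on its last entry only, not on \<open>\<xi>\<close>; this
  replaces transfinite induction over \<open>\<xi>\<close> by induction over the sequence below.
\<close>

lemma Cons_in_MT_iff: "a # t \<in> MT \<xi> \<longleftrightarrow> [a] \<in> MT \<xi> \<and> (\<exists>\<eta>. a = ord_succ \<eta> \<and> t \<in> MT \<eta>)"
  by (cases \<xi> rule: ord_cases) (auto simp: ord_succ_inject Nil_in_MT)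

lemma singleton_in_MT_bound: "[a] \<in> MT \<xi> \<Longrightarrow> \<exists>\<eta><\<xi>. a = ord_succ \<eta>"
proof (cases \<xi> rule: ord_cases)
  case 3
  then show "[a] \<in> MT \<xi> \<Longrightarrow> \<exists>\<eta><\<xi>. a = ord_succ \<eta>" by (auto split: if_splits)
qed (auto intro: less_ord_succ)

text \<open>
  At a successor \<open>\<xi>\<close> the only possible first entry is \<open>\<xi>\<close> itself, so an entry cannot be prescribed;
  it can only be chosen as large as required.
\<close>

lemma singleton_in_MT_cofinal:
  assumes "\<zeta> < \<xi>"
  shows "\<exists>b. [b] \<in> MT \<xi> \<and> \<zeta> < b"
proof (cases \<xi> rule: ord_cases)
  case 1
  then show ?thesis using assms ord_zero_le leD by blast
next
  case (2 \<eta>)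
  then show ?thesis using assms Nil_in_MT[of \<eta>] by auto
next
  case 3
  then show ?thesis using assms Nil_in_MT[of \<zeta>] less_ord_succ[of \<zeta>] by auto
qed

lemma MT_prefix_closed: "s @ r \<in> MT \<xi> \<Longrightarrow> s \<in> MT \<xi>"
proof (induction s arbitrary: \<xi>)
  case Nil
  show ?case by (rule Nil_in_MT)
next
  case (Cons a s)
  then show ?case using Cons_in_MT_iff[of a "s @ r" \<xi>] Cons_in_MT_iff[of a s \<xi>] by auto
qed

lemma MT_extend: "t @ [ord_succ \<eta>] \<in> MT \<xi> \<Longrightarrow> [b] \<in> MT \<eta> \<Longrightarrow> t @ [ord_succ \<eta>, b] \<in> MT \<xi>"
proof (induction t arbitrary: \<xi>)
  case Nil
  then show ?case using Cons_in_MT_iff[of "ord_succ \<eta>" "[b]" \<xi>] by auto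
next
  case (Cons a t)
  then show ?case
    using Cons_in_MT_iff[of a "t @ [ord_succ \<eta>]" \<xi>] Cons_in_MT_iff[of a "t @ [ord_succ \<eta>, b]" \<xi>]
    by auto
qed

lemma MT_entries: "t \<in> MT \<xi> \<Longrightarrow> a \<in> set t \<Longrightarrow> \<exists>\<eta><\<xi>. a = ord_succ \<eta>"
proof (induction t arbitrary: \<xi>)
  case (Cons b t)
  then obtain \<eta> where "b = ord_succ \<eta>" "t \<in> MT \<eta>" "\<eta> < \<xi>"
    by (metis Cons_in_MT_iff ord_succ_inject singleton_in_MT_bound)
  then show ?case using Cons.IH[of \<eta>] Cons.prems(2) by (auto dest: order.strict_trans)
qed simp

lemma MT_decreasing: "t \<in> MT \<xi> \<Longrightarrow> sorted_wrt (>) t"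
proof (induction t arbitrary: \<xi>)
  case (Cons b t)
  then obtain \<eta> where b: "b = ord_succ \<eta>" "t \<in> MT \<eta>" by (metis Cons_in_MT_iff)
  have "a < b" if "a \<in> set t" for a
    using MT_entries[OF b(2) that] b(1) by (auto simp: less_ord_succ_iff ord_succ_le)
  then show ?case using Cons.IH[OF b(2)] by simp
qed simp

lemma min_tree_snoc_cases:
  assumes "t \<in> min_tree \<xi>"
  obtains r \<eta> where "t = r @ [ord_succ \<eta>]" "\<eta> < \<xi>"
proof -
  obtain r a where t: "t = r @ [a]" using assms unfolding min_tree_def by (cases t rule: rev_cases) auto
  then show ?thesis using assms MT_entries[of t \<xi> a] that unfolding min_tree_def by auto
qed

lemma is_B_tree_min_tree: "is_B_tree {ord_succ ord_zero..\<xi>} (min_tree \<xi>)"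
proof -
  have "a \<in> {ord_succ ord_zero..\<xi>}" if "t \<in> MT \<xi>" "a \<in> set t" for t a
  proof -
    from MT_entries[OF that] obtain \<eta> where \<eta>: "\<eta> < \<xi>" "a = ord_succ \<eta>" by auto
    have "ord_zero < a" unfolding \<eta>(2) less_ord_succ_iff by (rule ord_zero_le)
    then show ?thesis using \<eta> ord_succ_le by auto
  qed
  moreover have "min_tree \<xi> \<union> {[]} = MT \<xi>" using Nil_in_MT[of \<xi>] by (auto simp: min_tree_def)
  ultimately show ?thesis
    unfolding is_B_tree_def is_tree_def
    by (auto simp: min_tree_def prefix_def intro: MT_prefix_closed)
qed

section \<open>The order of a minimal tree\<close>

text \<open>
  This governs one derivation step. Entries decrease, so above a node an entry exceeding \<open>\<zeta>\<close> needs
  \<open>\<zeta> + 1\<close> to be below the last entry \<open>\<eta> + 1\<close>; then \<open>\<zeta> < \<eta>\<close>, and the continuations in \<open>MT \<eta>\<close> are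
  cofinal enough to provide such an entry.
\<close>

lemma min_tree_has_extension_iff:
  assumes t: "t \<in> min_tree \<xi>"
  shows "(\<exists>s\<in>min_tree \<xi>. \<zeta> < last s \<and> strict_prefix t s) \<longleftrightarrow> ord_succ \<zeta> < last t"
proof
  assume "\<exists>s\<in>min_tree \<xi>. \<zeta> < last s \<and> strict_prefix t s"
  then obtain s where s: "s \<in> min_tree \<xi>" "\<zeta> < last s" "strict_prefix t s" by blast
  then obtain u where u: "s = t @ u" "u \<noteq> []" by (auto simp: strict_prefix_def prefix_def)
  have "t \<noteq> []" using t by (simp add: min_tree_def)
  moreover have "sorted_wrt (>) (t @ u)" using s(1) u MT_decreasing unfolding min_tree_def by blast
  ultimately have "last s < last t" using u by (simp add: sorted_wrt_append)
  then show "ord_succ \<zeta> < last t" using s(2) ord_succ_le by fastforce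
next
  assume less: "ord_succ \<zeta> < last t"
  obtain r \<eta> where r: "t = r @ [ord_succ \<eta>]" by (rule min_tree_snoc_cases[OF t])
  then have "\<zeta> < \<eta>" using less by (metis last_snoc leD leI less_ord_succ_iff ord_succ_le order_le_less)
  then obtain b where b: "[b] \<in> MT \<eta>" "\<zeta> < b" using singleton_in_MT_cofinal by blast
  have "t @ [b] \<in> min_tree \<xi>" using MT_extend[of r \<eta> \<xi> b] t b r by (auto simp: min_tree_def)
  then show "\<exists>s\<in>min_tree \<xi>. \<zeta> < last s \<and> strict_prefix t s" using b
    by (intro bexI[of _ "t @ [b]"]) (auto simp: strict_prefix_def)
qed

lemma tree_deriv_min_tree: "tree_deriv \<zeta> (min_tree \<xi>) = {t \<in> min_tree \<xi>. \<zeta> < last t}"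
proof (induction \<zeta> rule: less_induct)
  case (less \<zeta>)
  show ?case
  proof (cases \<zeta> rule: ord_cases)
    case 1
    have "ord_zero < last t" if "t \<in> min_tree \<xi>" for t
      using min_tree_snoc_cases[OF that] by (metis last_snoc less_ord_succ_iff ord_zero_le)
    then show ?thesis using 1 by auto
  next
    case (2 \<eta>)
    have IH: "tree_deriv \<eta> (min_tree \<xi>) = {t \<in> min_tree \<xi>. \<eta> < last t}"
      using less 2 less_ord_succ by blast
    show ?thesis unfolding 2 tree_deriv.simps IH max_nodes_def
      using min_tree_has_extension_iff[of _ \<xi> \<eta>] less_ord_succ[of \<eta>] by fastforce
  next
    case 3
    \<comment> \<open>The last entry is a successor, so it cannot equal the limit that it bounds from above.\<close>
    have "\<zeta> < last t" if "t \<in> min_tree \<xi>" and all: "\<And>\<eta>. \<eta> < \<zeta> \<Longrightarrow> \<eta> < last t" for t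
    proof -
      have "last t \<noteq> \<zeta>" using 3 min_tree_snoc_cases[OF that(1)] by (metis last_snoc not_is_limit(2))
      moreover have "\<not> last t < \<zeta>" using all by blast
      ultimately show ?thesis by auto
    qed
    moreover have "ord_zero < \<zeta>" using 3 ord_zero_le[of \<zeta>] by (auto simp: is_limit_def order_le_less)
    ultimately show ?thesis using 3 less by (auto dest: order.strict_trans)
  qed
qed

lemma tree_deriv_min_tree_eq_empty_iff: "tree_deriv \<zeta> (min_tree \<xi>) = {} \<longleftrightarrow> \<xi> \<le> \<zeta>"
proof
  assume empty: "tree_deriv \<zeta> (min_tree \<xi>) = {}"
  show "\<xi> \<le> \<zeta>"
  proof (rule leI, rule notI)
    assume "\<zeta> < \<xi>"
    then obtain b where "[b] \<in> MT \<xi>" "\<zeta> < b" using singleton_in_MT_cofinal by blast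
    then have "[b] \<in> tree_deriv \<zeta> (min_tree \<xi>)" unfolding tree_deriv_min_tree by (simp add: min_tree_def)
    then show False using empty by simp
  qed
next
  assume le: "\<xi> \<le> \<zeta>"
  have "last t \<le> \<zeta>" if "t \<in> min_tree \<xi>" for t
    using min_tree_snoc_cases[OF that] le by (metis last_snoc ord_succ_le order.trans)
  then show "tree_deriv \<zeta> (min_tree \<xi>) = {}" unfolding tree_deriv_min_tree by force
qed

lemma tree_order_min_tree: "tree_order (min_tree \<xi>) = Fin \<xi>"
  unfolding tree_order_def tree_deriv_min_tree_eq_empty_iff by (auto intro: Least_equality)

section \<open>Order preserving maps and derivatives\<close>

lemma Fin_le_tree_order_iff: "Fin \<xi> \<le> tree_order T \<longleftrightarrow> (\<forall>\<zeta><\<xi>. tree_deriv \<zeta> T \<noteq> {})"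
proof (cases "\<exists>\<zeta>::'a. tree_deriv \<zeta> T = {}")
  case True
  let ?L = "LEAST \<zeta>::'a. tree_deriv \<zeta> T = {}"
  have "tree_deriv ?L T = {}" using True by (rule LeastI_ex)
  moreover have "?L \<le> \<zeta>" if "tree_deriv \<zeta> T = {}" for \<zeta> using that by (rule Least_le)
  ultimately have "\<xi> \<le> ?L \<longleftrightarrow> (\<forall>\<zeta><\<xi>. tree_deriv \<zeta> T \<noteq> {})"
    by (meson leD leI order.strict_trans2)
  then show ?thesis using True unfolding tree_order_def by simp
next
  case False
  then show ?thesis unfolding tree_order_def by auto
qed

lemma tree_order_preserving_deriv:
  assumes f: "tree_order_preserving U T f"
  shows "f \<in> tree_deriv \<zeta> U \<rightarrow> tree_deriv \<zeta> T"
proof (induction \<zeta> rule: less_induct)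
  case (less \<zeta>)
  show ?case
  proof (cases \<zeta> rule: ord_cases)
    case 1
    then show ?thesis using f by (simp add: tree_order_preserving_def)
  next
    case (2 \<eta>)
    have IH: "f \<in> tree_deriv \<eta> U \<rightarrow> tree_deriv \<eta> T" using less 2 less_ord_succ by blast
    have sub: "tree_deriv \<eta> U \<subseteq> U" using tree_deriv_antimono[OF ord_zero_le[of \<eta>], of U] by simp
    have "f t \<in> tree_deriv (ord_succ \<eta>) T" if t: "t \<in> tree_deriv (ord_succ \<eta>) U" for t
    proof -
      obtain s where s: "t \<in> tree_deriv \<eta> U" "s \<in> tree_deriv \<eta> U" "strict_prefix t s"
        using t by (auto simp: max_nodes_def)
      then have "strict_prefix (f t) (f s)"
        using f sub unfolding tree_order_preserving_def by (meson monotone_onD subsetD)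
      then show ?thesis using s IH by (auto simp: max_nodes_def)
    qed
    then show ?thesis using 2 by auto
  next
    case 3
    then show ?thesis using less by fastforce
  qed
qed

lemma tree_order_mono:
  fixes U :: "'b list set" and T :: "'a list set"
  assumes "tree_order_preserving U T f"
  shows "(tree_order U :: 'o::{wellorder,no_top} extended) \<le> tree_order T"
proof -
  have nonempty: "tree_deriv \<zeta> T \<noteq> {}" if "tree_deriv \<zeta> U \<noteq> {}" for \<zeta> :: 'o
    using that tree_order_preserving_deriv[OF assms, of \<zeta>] by blast
  show ?thesis
  proof (cases "\<exists>\<zeta>::'o. tree_deriv \<zeta> U = {}")
    case True
    then obtain \<xi> :: 'o where \<xi>: "tree_order U = Fin \<xi>" unfolding tree_order_def by auto
    then have "\<forall>\<zeta><\<xi>. tree_deriv \<zeta> U \<noteq> {}" using Fin_le_tree_order_iff[of \<xi> U] by simp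
    then show ?thesis unfolding \<xi> Fin_le_tree_order_iff using nonempty by blast
  next
    case False
    then show ?thesis unfolding tree_order_def using nonempty by auto
  qed
qed

section \<open>Copying a minimal tree into a tree of large order\<close>

lemma tree_deriv_prefix_closed:
  assumes T: "is_B_tree S T" and s: "s \<in> tree_deriv \<zeta> T" and r: "prefix r s" "r \<noteq> []"
  shows "r \<in> tree_deriv \<zeta> T"
  using s
proof (induction \<zeta> rule: less_induct)
  case (less \<zeta>)
  show ?case
  proof (cases \<zeta> rule: ord_cases)
    case 1
    then show ?thesis using less.prems T r unfolding is_B_tree_def is_tree_def by auto
  next
    case (2 \<eta>)
    then have "s \<in> tree_deriv \<eta> T" using less.prems by simp
    moreover from this have "r \<in> tree_deriv \<eta> T" using less.IH 2 less_ord_succ by blast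
    ultimately show ?thesis using less.prems 2 r(1)
      by (cases "r = s") (auto simp: max_nodes_def strict_prefix_def)
  next
    case 3
    then show ?thesis using less by auto
  qed
qed

lemma tree_deriv_extend:
  assumes T: "is_B_tree S T" and s: "s \<in> tree_deriv \<eta> T" "strict_prefix u s"
  shows "\<exists>x. u @ [x] \<in> tree_deriv \<eta> T"
proof -
  obtain x r where "s = u @ x # r" using s(2) by (rule strict_prefixE')
  then have "prefix (u @ [x]) s" by (auto simp: prefix_def)
  then show ?thesis using tree_deriv_prefix_closed[OF T s(1)] by blast
qed

text \<open>
  An entry \<open>a = \<eta> + 1\<close> asks for membership in the \<open>\<eta>\<close>-th derivative. Derivatives decrease, so this
  is membership in all derivatives of index below \<open>a\<close>, which avoids naming the predecessor of \<open>a\<close>.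
\<close>

definition branch :: "'a list set \<Rightarrow> 'o::{wellorder,no_top} list \<Rightarrow> 'a list" where
  "branch T = foldl (\<lambda>u a. u @ [SOME x. \<forall>\<zeta><a. u @ [x] \<in> tree_deriv \<zeta> T]) []"

lemma map_last_branch: "map (\<lambda>i. last (branch T (take i t))) [1..<Suc (length t)] = branch T t"
proof (induction t rule: rev_induct)
  case (snoc a t)
  have "map (\<lambda>i. last (branch T (take i (t @ [a])))) [1..<Suc (length t)]
      = map (\<lambda>i. last (branch T (take i t))) [1..<Suc (length t)]" by auto
  also have "\<dots> = branch T t" by (rule snoc)
  finally show ?case by (simp add: branch_def)
qed (simp add: branch_def)

lemma branch_snoc_in_tree_deriv:
  assumes "\<exists>x. branch T t @ [x] \<in> tree_deriv \<eta> T"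
  shows "branch T (t @ [ord_succ \<eta>]) \<in> tree_deriv \<eta> T"
proof -
  have "\<exists>x. \<forall>\<zeta><ord_succ \<eta>. branch T t @ [x] \<in> tree_deriv \<zeta> T"
    using assms tree_deriv_antimono[of _ \<eta> T] by (auto simp: less_ord_succ_iff)
  from someI_ex[OF this] show ?thesis by (simp add: branch_def less_ord_succ)
qed

text \<open>
  Any node of the \<open>\<eta>\<close>-th derivative can be continued as long as the requested entries decrease, and
  those of a node of a minimal tree do. The order hypothesis enters only through the first letter.
\<close>

lemma branch_in_tree_deriv:
  assumes T: "is_B_tree S T" and order: "\<forall>\<zeta><\<xi>. tree_deriv \<zeta> T \<noteq> {}"
  shows "t @ [ord_succ \<eta>] \<in> MT \<xi> \<Longrightarrow> branch T (t @ [ord_succ \<eta>]) \<in> tree_deriv \<eta> T"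
proof (induction t arbitrary: \<eta> rule: rev_induct)
  case Nil
  then have "\<eta> < \<xi>" using singleton_in_MT_bound[of "ord_succ \<eta>" \<xi>] by (auto simp: ord_succ_inject)
  then obtain s where s: "s \<in> tree_deriv \<eta> T" using order by blast
  then have "s \<in> T" using tree_deriv_antimono[OF ord_zero_le[of \<eta>], of T] by auto
  then have "s \<noteq> []" using T by (auto simp: is_B_tree_def)
  then show ?case using tree_deriv_extend[OF T s, of "[]"]
    by (intro branch_snoc_in_tree_deriv) (simp add: branch_def strict_prefix_def)
next
  case (snoc a t)
  have prefix: "t @ [a] \<in> MT \<xi>" using snoc.prems by (rule MT_prefix_closed)
  then obtain \<theta> where \<theta>: "a = ord_succ \<theta>" using MT_entries[of "t @ [a]" \<xi> a] by auto
  \<comment> \<open>The image survives one derivation more than the next letter requires, hence is not maximal.\<close>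
  have "ord_succ \<eta> < a" using MT_decreasing[OF snoc.prems] by (simp add: sorted_wrt_append)
  then have le: "ord_succ \<eta> \<le> \<theta>" by (simp add: \<theta> less_ord_succ_iff)
  have "branch T (t @ [a]) \<in> tree_deriv \<theta> T" using snoc.IH prefix by (simp add: \<theta>)
  then have "branch T (t @ [a]) \<in> tree_deriv (ord_succ \<eta>) T" using tree_deriv_antimono[OF le] by blast
  then obtain s where "s \<in> tree_deriv \<eta> T" "strict_prefix (branch T (t @ [a])) s"
    by (auto simp: max_nodes_def)
  then show ?case using tree_deriv_extend[OF T] by (intro branch_snoc_in_tree_deriv) blast
qed

lemma labelling_of_large_order:
  assumes T: "is_B_tree S T" and order: "\<forall>\<zeta><\<xi>. tree_deriv \<zeta> T \<noteq> {}"
  shows "\<exists>f. f \<in> min_tree \<xi> \<rightarrow> S \<and>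
    (\<forall>t\<in>min_tree \<xi>. map (\<lambda>i. f (take i t)) [1..<Suc (length t)] \<in> T)"
proof -
  have branch: "branch T t \<in> T" if t: "t \<in> min_tree \<xi>" for t
  proof -
    obtain r \<eta> where r: "t = r @ [ord_succ \<eta>]" by (rule min_tree_snoc_cases[OF t])
    then have "branch T t \<in> tree_deriv \<eta> T"
      using t branch_in_tree_deriv[OF T order, of r \<eta>] by (simp add: min_tree_def)
    then show ?thesis using tree_deriv_antimono[OF ord_zero_le[of \<eta>], of T] by auto
  qed
  have "last (branch T t) \<in> S" if "t \<in> min_tree \<xi>" for t
  proof -
    have "branch T t \<in> lists S - {[]}" using branch[OF that] T by (auto simp: is_B_tree_def)
    then show ?thesis by (auto dest: last_in_set)
  qed
  then show ?thesis using branch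
    by (intro exI[of _ "\<lambda>t. last (branch T t)"]) (simp only: map_last_branch Pi_iff, blast)
qed

lemma tree_order_preserving_labelling:
  assumes "\<forall>t\<in>U. map (\<lambda>i. f (take i t)) [1..<Suc (length t)] \<in> T"
  shows "tree_order_preserving U T (\<lambda>t. map (\<lambda>i. f (take i t)) [1..<Suc (length t)])"
proof -
  let ?F = "\<lambda>t. map (\<lambda>i. f (take i t)) [1..<Suc (length t)]"
  have "strict_prefix (?F s) (?F t)" if st: "strict_prefix s t" for s t
  proof -
    obtain a r where t: "t = s @ a # r" using st by (rule strict_prefixE')
    have "[1..<Suc (length t)] = [1..<Suc (length s)] @ [Suc (length s)..<Suc (length t)]"
      using upt_add_eq_append[of 1 "Suc (length s)" "Suc (length r)"] by (simp add: t del: upt_Suc)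
    moreover have "map (\<lambda>i. f (take i t)) [1..<Suc (length s)] = ?F s" by (auto simp: t)
    ultimately have "prefix (?F s) (?F t)" by (simp add: prefix_def del: upt_Suc)
    moreover have "length (?F s) \<noteq> length (?F t)" by (simp add: t del: upt_Suc)
    ultimately show ?thesis unfolding strict_prefix_def by metis
  qed
  then show ?thesis using assms unfolding tree_order_preserving_def
    by (auto intro: monotone_onI simp del: upt_Suc)
qed

theorem proposition2p3:
  fixes \<xi> :: "'o::{wellorder,no_top}"
    and S :: "'a set" and T :: "'a list set"
  assumes "is_B_tree S T"
  shows
    "(is_B_tree {ord_succ ord_zero..\<xi>} (min_tree \<xi>) \<and> tree_order (min_tree \<xi>) = Fin \<xi>)
     \<and> (\<forall>(R::'b set) U. is_B_tree R U \<and> (\<exists>f. tree_order_preserving U T f)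
          \<longrightarrow> (tree_order T :: 'o extended) \<ge> tree_order U)
     \<and> (tree_order T \<ge> Fin \<xi> \<longleftrightarrow> (\<exists>f. tree_order_preserving (min_tree \<xi>) T f))
     \<and> (tree_order T \<ge> Fin \<xi> \<longleftrightarrow>
          (\<exists>f. f \<in> min_tree \<xi> \<rightarrow> S \<and>
             (\<forall>t\<in>min_tree \<xi>. map (\<lambda>i. f (take i t)) [1..<Suc (length t)] \<in> T)))"
proof (intro conjI)
  show "is_B_tree {ord_succ ord_zero..\<xi>} (min_tree \<xi>)" by (rule is_B_tree_min_tree)
  show "tree_order (min_tree \<xi>) = Fin \<xi>" by (rule tree_order_min_tree)
  show "\<forall>(R::'b set) U. is_B_tree R U \<and> (\<exists>f. tree_order_preserving U T f)
      \<longrightarrow> (tree_order T :: 'o extended) \<ge> tree_order U"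
    using tree_order_mono by blast
  let ?order = "tree_order T \<ge> Fin \<xi>"
  let ?map = "\<exists>f. tree_order_preserving (min_tree \<xi>) T f"
  let ?labelling = "\<exists>f. f \<in> min_tree \<xi> \<rightarrow> S \<and>
    (\<forall>t\<in>min_tree \<xi>. map (\<lambda>i. f (take i t)) [1..<Suc (length t)] \<in> T)"
  have order_labelling: ?labelling if ?order
    using that labelling_of_large_order[OF assms] unfolding Fin_le_tree_order_iff by blast
  have labelling_map: ?map if ?labelling
    using that tree_order_preserving_labelling by blast
  have map_order: ?order if ?map
    using that tree_order_mono tree_order_min_tree[of \<xi>] by metis
  show "?order \<longleftrightarrow> ?map" using order_labelling labelling_map map_order by blast
  show "?order \<longleftrightarrow> ?labelling" using order_labelling labelling_map map_order by blast
qed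

end
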